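(* Let $\Phi: X\times G\to X$ be a right action of a group $G$ on a non-empty set $X$, written $x^g:=\Phi(x,g)$, and let $X\times_\Phi G$ be the associated quandle on the set $X\times G$. For $m\in\mathbb{Z}$ define the map $\zeta_m: X\times_\Phi G\to X\times_\Phi G$ by $\zeta_m(x,g):=(x^{g^m},g)$. Then there is a group isomorphism $$\mathrm{Inn}(X\times_\Phi G)\;\cong\; Z\times G/(Z(G)\cap K),$$ where $Z=\{\zeta_m\mid m\in\mathbb{Z}\}$ (a group under composition), $Z(G)$ is the center of $G$, and $K=\{g\in G\mid x^g=x\text{ for all }x\in X\}$ is the kernel of $\Phi$.
   Context: A quandle is a non-empty set $Q$ with a binary operation $\triangleleft$ such that: (Q1) $x\triangleleft x=x$ for all $x$; (Q2) for every $y\in Q$ the map $s_y:Q\to Q$, $s_y(x):=x\triangleleft y$ (the point symmetry at $y$), is bijective; (Q3) $(x\triangleleft y)\triangleleft z=(x\triangleleft z)\triangleleft(y\triangleleft z)$ for all $x,y,z$. Each $s_y$ is then an automorphism of $Q$. Automorphisms are multiplied from left to right ($fg:=g\circ f$), so they act on $Q$ from the right. $\mathrm{Inn}(Q)$ is the subgroup of $\mathrm{Aut}(Q)$ generated by $\{s_y\mid y\in Q\}$. For a right action $\Phi$ of $G$ on $X$, $X\times_\Phi G$ denotes the quandle with underlying set $X\times G$ and operation $(x,g)\triangleleft_\Phi(y,h):=(x^{g^{-1}h},h^{-1}gh)$. *)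

theory Defs
  imports "HOL-Algebra.Bij" "HOL-Algebra.Generated_Groups"
begin

section \<open>Quandles\<close>

record 'a quandle = "'a partial_object" +
  qop :: "'a \<Rightarrow> 'a \<Rightarrow> 'a"  (infixl \<open>\<triangleleft>\<index>\<close> 70)

definition point_symmetry :: "('a, 'b) quandle_scheme \<Rightarrow> 'a \<Rightarrow> 'a \<Rightarrow> 'a" where
  "point_symmetry Q y = (\<lambda>x \<in> carrier Q. x \<triangleleft>\<^bsub>Q\<^esub> y)"

locale quandle =
  fixes Q (structure)
  assumes nonempty: "carrier Q \<noteq> {}"
    and op_closed: "\<lbrakk>x \<in> carrier Q; y \<in> carrier Q\<rbrakk> \<Longrightarrow> x \<triangleleft> y \<in> carrier Q"
    and idem: "x \<in> carrier Q \<Longrightarrow> x \<triangleleft> x = x"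
    and bij_point_symmetry:
      "y \<in> carrier Q \<Longrightarrow> bij_betw (point_symmetry Q y) (carrier Q) (carrier Q)"
    and self_distrib:
      "\<lbrakk>x \<in> carrier Q; y \<in> carrier Q; z \<in> carrier Q\<rbrakk>
        \<Longrightarrow> (x \<triangleleft> y) \<triangleleft> z = (x \<triangleleft> z) \<triangleleft> (y \<triangleleft> z)"

section \<open>Automorphisms\<close>

text \<open>Maps are multiplied from left to right, so the product of \<open>f\<close> and \<open>g\<close> is
  \<open>g \<circ> f\<close>, the opposite of the convention of \<^const>\<open>BijGroup\<close>. As there, only extensional
  functions are used, so that maps of \<open>S\<close> are determined by their values on \<open>S\<close>.\<close>

definition map_group :: "'a set \<Rightarrow> ('a \<Rightarrow> 'a) set \<Rightarrow> ('a \<Rightarrow> 'a) monoid" where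
  "map_group S F = \<lparr>carrier = F, mult = (\<lambda>f g. compose S g f), one = (\<lambda>x \<in> S. x)\<rparr>"

definition quandle_auto :: "('a, 'b) quandle_scheme \<Rightarrow> ('a \<Rightarrow> 'a) set" where
  "quandle_auto Q =
    {f \<in> Bij (carrier Q). \<forall>x \<in> carrier Q. \<forall>y \<in> carrier Q. f (x \<triangleleft>\<^bsub>Q\<^esub> y) = f x \<triangleleft>\<^bsub>Q\<^esub> f y}"

definition Aut :: "('a, 'b) quandle_scheme \<Rightarrow> ('a \<Rightarrow> 'a) monoid" where
  "Aut Q = map_group (carrier Q) (quandle_auto Q)"

definition Inn :: "('a, 'b) quandle_scheme \<Rightarrow> ('a \<Rightarrow> 'a) monoid" where
  "Inn Q = (Aut Q)\<lparr>carrier := generate (Aut Q) (point_symmetry Q ` carrier Q)\<rparr>"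

lemma (in quandle) group_Aut: "group (Aut Q)"
proof (rule groupI)
  fix f g h
  assume f: "f \<in> carrier (Aut Q)"
  then have fB: "f \<in> Bij (carrier Q)"
    and fh: "\<And>x y. x \<in> carrier Q \<Longrightarrow> y \<in> carrier Q \<Longrightarrow> f (x \<triangleleft> y) = f x \<triangleleft> f y"
    by (auto simp: Aut_def map_group_def quandle_auto_def)
  note f_in = Bij_imp_funcset[OF fB]
  show "\<one>\<^bsub>Aut Q\<^esub> \<otimes>\<^bsub>Aut Q\<^esub> f = f"
    using f_in Bij_imp_extensional[OF fB] by (simp add: Aut_def map_group_def)
  have "restrict (inv_into (carrier Q) f) (carrier Q) \<in> carrier (Aut Q)"
    using Bij_inv_into_lemma[where g = "(\<triangleleft>)", OF fh fB] restrict_inv_into_Bij[OF fB]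
    by (simp add: Aut_def map_group_def quandle_auto_def op_closed)
  moreover have "restrict (inv_into (carrier Q) f) (carrier Q) \<otimes>\<^bsub>Aut Q\<^esub> f = \<one>\<^bsub>Aut Q\<^esub>"
    using fB by (auto simp: Aut_def map_group_def compose_def Bij_def bij_betw_def
        f_inv_into_f intro!: restrict_ext)
  ultimately show "\<exists>k\<in>carrier (Aut Q). k \<otimes>\<^bsub>Aut Q\<^esub> f = \<one>\<^bsub>Aut Q\<^esub>" by blast
  assume g: "g \<in> carrier (Aut Q)"
  then have gB: "g \<in> Bij (carrier Q)"
    and gh: "\<And>x y. x \<in> carrier Q \<Longrightarrow> y \<in> carrier Q \<Longrightarrow> g (x \<triangleleft> y) = g x \<triangleleft> g y"
    by (auto simp: Aut_def map_group_def quandle_auto_def)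
  show "f \<otimes>\<^bsub>Aut Q\<^esub> g \<in> carrier (Aut Q)"
    using compose_Bij[OF gB fB] fh gh funcset_mem[OF f_in]
    by (simp add: Aut_def map_group_def quandle_auto_def compose_eq op_closed)
  show "f \<otimes>\<^bsub>Aut Q\<^esub> g \<otimes>\<^bsub>Aut Q\<^esub> h = f \<otimes>\<^bsub>Aut Q\<^esub> (g \<otimes>\<^bsub>Aut Q\<^esub> h)"
    using f_in by (simp add: Aut_def map_group_def compose_assoc)
next
  show "\<one>\<^bsub>Aut Q\<^esub> \<in> carrier (Aut Q)"
    using id_Bij by (auto simp: Aut_def map_group_def quandle_auto_def op_closed)
qed

lemma (in quandle) point_symmetry_auto:
  assumes "y \<in> carrier Q"
  shows "point_symmetry Q y \<in> carrier (Aut Q)"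
  using assms bij_point_symmetry
  by (auto simp: Aut_def map_group_def quandle_auto_def Bij_def point_symmetry_def op_closed
      intro: self_distrib)

lemma (in quandle) subgroup_Inn: "subgroup (carrier (Inn Q)) (Aut Q)"
  using group.generate_is_subgroup[OF group_Aut, of "point_symmetry Q ` carrier Q"]
    point_symmetry_auto by (auto simp: Inn_def)

lemma (in quandle) group_Inn: "group (Inn Q)"
  using subgroup.subgroup_is_group[OF subgroup_Inn group_Aut] by (simp add: Inn_def)

section \<open>The quandle of a right group action\<close>

locale right_action = group G for G (structure) +
  fixes X :: "'x set" and \<Phi> :: "'x \<Rightarrow> 'a \<Rightarrow> 'x"
  assumes act_closed: "\<lbrakk>x \<in> X; g \<in> carrier G\<rbrakk> \<Longrightarrow> \<Phi> x g \<in> X"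
    and act_one: "x \<in> X \<Longrightarrow> \<Phi> x \<one> = x"
    and act_mult: "\<lbrakk>x \<in> X; g \<in> carrier G; h \<in> carrier G\<rbrakk> \<Longrightarrow> \<Phi> x (g \<otimes> h) = \<Phi> (\<Phi> x g) h"

definition action_quandle ::
  "('g, 'c) monoid_scheme \<Rightarrow> 'x set \<Rightarrow> ('x \<Rightarrow> 'g \<Rightarrow> 'x) \<Rightarrow> ('x \<times> 'g) quandle" where
  "action_quandle G X \<Phi> =
    \<lparr>carrier = X \<times> carrier G,
     qop = (\<lambda>(x, g) (y, h).
       (\<Phi> x (inv\<^bsub>G\<^esub> g \<otimes>\<^bsub>G\<^esub> h), inv\<^bsub>G\<^esub> h \<otimes>\<^bsub>G\<^esub> g \<otimes>\<^bsub>G\<^esub> h))\<rparr>"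

definition action_kernel ::
  "('g, 'c) monoid_scheme \<Rightarrow> 'x set \<Rightarrow> ('x \<Rightarrow> 'g \<Rightarrow> 'x) \<Rightarrow> 'g set" where
  "action_kernel G X \<Phi> = {g \<in> carrier G. \<forall>x \<in> X. \<Phi> x g = x}"

definition center :: "('g, 'c) monoid_scheme \<Rightarrow> 'g set" where
  "center G = {z \<in> carrier G. \<forall>g \<in> carrier G. z \<otimes>\<^bsub>G\<^esub> g = g \<otimes>\<^bsub>G\<^esub> z}"

definition zeta ::
  "('g, 'c) monoid_scheme \<Rightarrow> 'x set \<Rightarrow> ('x \<Rightarrow> 'g \<Rightarrow> 'x) \<Rightarrow> int \<Rightarrow> 'x \<times> 'g \<Rightarrow> 'x \<times> 'g" where
  "zeta G X \<Phi> m = (\<lambda>(x, g) \<in> X \<times> carrier G. (\<Phi> x (g [^]\<^bsub>G\<^esub> m), g))"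

definition zeta_group ::
  "('g, 'c) monoid_scheme \<Rightarrow> 'x set \<Rightarrow> ('x \<Rightarrow> 'g \<Rightarrow> 'x) \<Rightarrow> ('x \<times> 'g \<Rightarrow> 'x \<times> 'g) monoid" where
  "zeta_group G X \<Phi> = map_group (X \<times> carrier G) {zeta G X \<Phi> m | m. m \<in> (UNIV :: int set)}"

lemma (in group) mult_inv_cancel_left:
  "\<lbrakk>a \<in> carrier G; b \<in> carrier G\<rbrakk> \<Longrightarrow> a \<otimes> (inv a \<otimes> b) = b"
  "\<lbrakk>a \<in> carrier G; b \<in> carrier G\<rbrakk> \<Longrightarrow> inv a \<otimes> (a \<otimes> b) = b"
  by (simp_all add: m_assoc[symmetric])

lemma (in right_action) quandle_action_quandle:
  assumes "X \<noteq> {}"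
  shows "quandle (action_quandle G X \<Phi>)"
proof
  show "carrier (action_quandle G X \<Phi>) \<noteq> {}"
    using assms by (auto simp: action_quandle_def)
next
  fix p
  assume "p \<in> carrier (action_quandle G X \<Phi>)"
  then show "p \<triangleleft>\<^bsub>action_quandle G X \<Phi>\<^esub> p = p"
    by (auto simp: action_quandle_def act_one)
next
  fix p q
  assume "p \<in> carrier (action_quandle G X \<Phi>)" "q \<in> carrier (action_quandle G X \<Phi>)"
  then show "p \<triangleleft>\<^bsub>action_quandle G X \<Phi>\<^esub> q \<in> carrier (action_quandle G X \<Phi>)"
    by (auto simp: action_quandle_def act_closed)
next
  fix p q r
  assume "p \<in> carrier (action_quandle G X \<Phi>)" "q \<in> carrier (action_quandle G X \<Phi>)"
    "r \<in> carrier (action_quandle G X \<Phi>)"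
  then show "p \<triangleleft>\<^bsub>action_quandle G X \<Phi>\<^esub> q \<triangleleft>\<^bsub>action_quandle G X \<Phi>\<^esub> r =
      p \<triangleleft>\<^bsub>action_quandle G X \<Phi>\<^esub> r \<triangleleft>\<^bsub>action_quandle G X \<Phi>\<^esub> (q \<triangleleft>\<^bsub>action_quandle G X \<Phi>\<^esub> r)"
    by (auto simp: action_quandle_def act_mult[symmetric] inv_mult_group m_assoc
        mult_inv_cancel_left)
next
  fix q
  assume q: "q \<in> carrier (action_quandle G X \<Phi>)"
  then obtain y h where [simp]: "q = (y, h)" "h \<in> carrier G"
    by (auto simp: action_quandle_def)
  show "bij_betw (point_symmetry (action_quandle G X \<Phi>) q)
      (carrier (action_quandle G X \<Phi>)) (carrier (action_quandle G X \<Phi>))"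
    by (rule bij_betw_byWitness
        [where f' = "\<lambda>(x, g). (\<Phi> x (inv h \<otimes> (h \<otimes> g \<otimes> inv h)), h \<otimes> g \<otimes> inv h)"])
      (auto simp: point_symmetry_def action_quandle_def act_mult[symmetric] act_closed act_one
        inv_mult_group m_assoc mult_inv_cancel_left)
qed

lemma (in right_action) normal_center_Int_kernel:
  "center G \<inter> action_kernel G X \<Phi> \<lhd> G"
proof (rule normal_invI)
  show "subgroup (center G \<inter> action_kernel G X \<Phi>) G"
  proof (rule subgroupI)
    have "\<one> \<in> center G \<inter> action_kernel G X \<Phi>"
      by (auto simp: center_def action_kernel_def act_one)
    then show "center G \<inter> action_kernel G X \<Phi> \<noteq> {}" by blast
  next
    fix a
    assume a: "a \<in> center G \<inter> action_kernel G X \<Phi>"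
    then have aG: "a \<in> carrier G" by (simp add: center_def)
    have "inv a \<otimes> g = g \<otimes> inv a" if g: "g \<in> carrier G" for g
    proof -
      have "inv a \<otimes> g = inv a \<otimes> (g \<otimes> a) \<otimes> inv a"
        using g aG by (simp add: m_assoc)
      also have "g \<otimes> a = a \<otimes> g"
        using a g unfolding center_def by force
      finally show ?thesis
        using g aG by (simp add: mult_inv_cancel_left)
    qed
    moreover have "\<Phi> x (inv a) = x" if x: "x \<in> X" for x
    proof -
      have "\<Phi> x (inv a) = \<Phi> (\<Phi> x a) (inv a)"
        using a x unfolding action_kernel_def by auto
      then show ?thesis
        using x aG by (simp add: act_mult[symmetric] act_one)
    qed
    moreover have "inv a \<in> carrier G"
      using aG by (rule inv_closed)
    ultimately show "inv a \<in> center G \<inter> action_kernel G X \<Phi>"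
      unfolding center_def action_kernel_def by blast
  next
    fix a b
    assume a: "a \<in> center G \<inter> action_kernel G X \<Phi>"
      and b: "b \<in> center G \<inter> action_kernel G X \<Phi>"
    have aG: "a \<in> carrier G" and bG: "b \<in> carrier G"
      using a b by (simp_all add: center_def)
    have "a \<otimes> b \<otimes> g = g \<otimes> (a \<otimes> b)" if g: "g \<in> carrier G" for g
    proof -
      have ag: "a \<otimes> g = g \<otimes> a" and bg: "b \<otimes> g = g \<otimes> b"
        using a b g unfolding center_def by blast+
      have "a \<otimes> b \<otimes> g = a \<otimes> g \<otimes> b"
        using aG bG g by (simp only: m_assoc bg)
      then show ?thesis
        using aG bG g by (simp only: m_assoc ag)
    qed
    moreover have "\<Phi> x (a \<otimes> b) = x" if x: "x \<in> X" for x
    proof -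
      have "\<Phi> x a = x" "\<Phi> x b = x"
        using a b x unfolding action_kernel_def by blast+
      then show ?thesis
        using x aG bG by (simp add: act_mult)
    qed
    moreover have "a \<otimes> b \<in> carrier G"
      using aG bG by (rule m_closed)
    ultimately show "a \<otimes> b \<in> center G \<inter> action_kernel G X \<Phi>"
      unfolding center_def action_kernel_def by blast
  qed (auto simp: center_def)
next
  fix g n
  assume g: "g \<in> carrier G" and n: "n \<in> center G \<inter> action_kernel G X \<Phi>"
  have nG: "n \<in> carrier G"
    using n by (simp add: center_def)
  have "n \<otimes> g = g \<otimes> n"
    using n g unfolding center_def by blast
  then have "g \<otimes> n \<otimes> inv g = n \<otimes> g \<otimes> inv g" by simp
  also have "\<dots> = n"
    using nG g by (simp add: m_assoc)
  finally show "g \<otimes> n \<otimes> inv g \<in> center G \<inter> action_kernel G X \<Phi>" using n by simp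
qed

end

theory Submission
  imports Defs "HOL-Algebra.Elementary_Groups"
begin

text \<open>Besides the maps \<open>\<zeta>\<^sub>m\<close>, every \<open>h \<in> G\<close> gives an automorphism
  \<open>\<rho>\<^sub>h (x, g) = (x\<^sup>h, h\<^sup>-\<^sup>1 g h)\<close> of the quandle \<open>X \<times>\<^sub>\<Phi> G\<close>: the group \<open>G\<close> acts on both factors, on
  the second by conjugation. The point symmetry at \<open>(y, h)\<close> is \<open>\<zeta>\<^sub>-\<^sub>1\<close> followed by \<open>\<rho>\<^sub>h\<close>. For
  \<open>h = 1\<close> this says that \<open>\<zeta>\<^sub>-\<^sub>1\<close> itself is inner, hence so are all \<open>\<zeta>\<^sub>m\<close> and then all \<open>\<rho>\<^sub>h\<close>.
  Since conjugation commutes with taking powers, \<open>\<zeta>\<^sub>m\<close> and \<open>\<rho>\<^sub>h\<close> commute, so the inner group is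
  the product of the two commuting subgroups \<open>Z\<close> and \<open>\<rho>(G)\<close>.

  The product is direct. If \<open>\<zeta>\<^sub>m = \<rho>\<^sub>h\<close>, evaluation at the points \<open>(x, 1)\<close>, which \<open>\<zeta>\<^sub>m\<close> fixes,
  shows that \<open>h\<close> acts trivially on \<open>X\<close>, and comparison of the second coordinates shows that \<open>h\<close>
  is central; so \<open>\<rho>\<^sub>h\<close> is the identity. The same two conditions on \<open>h\<close> describe the kernel of
  \<open>\<rho>\<close>, which is therefore \<open>Z(G) \<inter> K\<close>, and the first isomorphism theorem turns the second
  factor \<open>\<rho>(G)\<close> into \<open>G/(Z(G) \<inter> K)\<close>.\<close>

section \<open>Commuting subgroups and powers of conjugates\<close>

text \<open>The product set is the image of the homomorphism \<open>(x, y) \<mapsto> xy\<close> on the direct product.\<close>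

lemma (in group) subgroup_set_mult_commuting:
  assumes A: "subgroup A G" and B: "subgroup B G"
    and comm: "\<And>x y. \<lbrakk>x \<in> A; y \<in> B\<rbrakk> \<Longrightarrow> x \<otimes> y = y \<otimes> x"
  shows "subgroup (A <#> B) G"
proof -
  interpret group_disjoint_sum G A B
    using A B by (simp add: group_disjoint_sum_def is_group)
  interpret P: group_hom "subgroup_generated G A \<times>\<times> subgroup_generated G B" G "\<lambda>(x, y). x \<otimes> y"
    using comm hom_group_mul_eq
    by (auto intro!: group_hom.intro group_hom_axioms.intro DirProd_group is_group)
  have "(\<lambda>(x, y). x \<otimes> y) ` carrier (subgroup_generated G A \<times>\<times> subgroup_generated G B) = A <#> B"
    by (auto simp: set_mult_def)
  then show ?thesis
    using P.img_is_subgroup by simp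
qed

text \<open>Conjugation is an endomorphism, hence compatible with powers. The right-associated form is the
  normal form of \<open>m_assoc\<close>, so that both can be used together as rewrite rules.\<close>

lemma (in group) int_pow_conj:
  fixes m :: int
  assumes g: "g \<in> carrier G" and h: "h \<in> carrier G"
  shows "(inv h \<otimes> (g \<otimes> h)) [^] m = inv h \<otimes> (g [^] m \<otimes> h)"
proof -
  have "(\<lambda>g. inv h \<otimes> (g \<otimes> h)) \<in> hom G G"
    using h by (auto intro!: homI simp: m_assoc mult_inv_cancel_left)
  from hom_int_pow[OF this g is_group is_group] show ?thesis by simp
qed

section \<open>Two commuting families of automorphisms\<close>

definition conj_map ::
  "('g, 'c) monoid_scheme \<Rightarrow> 'x set \<Rightarrow> ('x \<Rightarrow> 'g \<Rightarrow> 'x) \<Rightarrow> 'g \<Rightarrow> 'x \<times> 'g \<Rightarrow> 'x \<times> 'g" where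
  "conj_map G X \<Phi> h = (\<lambda>(x, g) \<in> X \<times> carrier G. (\<Phi> x h, inv\<^bsub>G\<^esub> h \<otimes>\<^bsub>G\<^esub> g \<otimes>\<^bsub>G\<^esub> h))"

lemma mult_Aut: "f \<otimes>\<^bsub>Aut Q\<^esub> g = compose (carrier Q) g f"
  and one_Aut: "\<one>\<^bsub>Aut Q\<^esub> = (\<lambda>x \<in> carrier Q. x)"
  and mult_Inn: "f \<otimes>\<^bsub>Inn Q\<^esub> g = f \<otimes>\<^bsub>Aut Q\<^esub> g"
  and one_Inn: "\<one>\<^bsub>Inn Q\<^esub> = \<one>\<^bsub>Aut Q\<^esub>"
  by (simp_all add: Inn_def Aut_def map_group_def)

context right_action
begin

abbreviation \<Q> where "\<Q> \<equiv> action_quandle G X \<Phi>"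
abbreviation \<zeta> where "\<zeta> \<equiv> zeta G X \<Phi>"
abbreviation \<rho> where "\<rho> \<equiv> conj_map G X \<Phi>"

lemma carrier_action_quandle [simp]: "carrier \<Q> = X \<times> carrier G"
  by (simp add: action_quandle_def)

lemma action_quandle_op [simp]:
  "(x, g) \<triangleleft>\<^bsub>\<Q>\<^esub> (y, h) = (\<Phi> x (inv g \<otimes> h), inv h \<otimes> g \<otimes> h)"
  by (simp add: action_quandle_def)

lemma zeta_apply: "\<lbrakk>x \<in> X; g \<in> carrier G\<rbrakk> \<Longrightarrow> \<zeta> m (x, g) = (\<Phi> x (g [^] m), g)"
  by (simp add: zeta_def)

lemma conj_map_apply:
  "\<lbrakk>x \<in> X; g \<in> carrier G\<rbrakk> \<Longrightarrow> \<rho> h (x, g) = (\<Phi> x h, inv h \<otimes> g \<otimes> h)"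
  by (simp add: conj_map_def)

lemma zeta_mult: "\<zeta> m \<otimes>\<^bsub>Aut \<Q>\<^esub> \<zeta> n = \<zeta> (m + n)"
  by (rule extensionalityI[where A = "X \<times> carrier G"])
    (auto simp: mult_Aut compose_eq zeta_apply act_closed int_pow_mult act_mult,
     auto simp: zeta_def)

lemma zeta_zero: "\<zeta> 0 = \<one>\<^bsub>Aut \<Q>\<^esub>"
  by (rule extensionalityI[where A = "X \<times> carrier G"])
    (auto simp: one_Aut zeta_apply act_one, auto simp: zeta_def)

lemma conj_map_mult:
  assumes "h \<in> carrier G" and "k \<in> carrier G"
  shows "\<rho> h \<otimes>\<^bsub>Aut \<Q>\<^esub> \<rho> k = \<rho> (h \<otimes> k)"
  using assms
  by (intro extensionalityI[where A = "X \<times> carrier G"])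
    (auto simp: mult_Aut compose_eq conj_map_apply act_closed act_mult inv_mult_group m_assoc,
     auto simp: conj_map_def)

lemma conj_map_one: "\<rho> \<one> = \<one>\<^bsub>Aut \<Q>\<^esub>"
  by (rule extensionalityI[where A = "X \<times> carrier G"])
    (auto simp: one_Aut conj_map_apply act_one, auto simp: conj_map_def)

text \<open>On first coordinates this is \<open>g\<^sup>m h = h (h\<^sup>-\<^sup>1 g h)\<^sup>m\<close>.\<close>

lemma zeta_conj_map_commute:
  assumes "h \<in> carrier G"
  shows "\<zeta> m \<otimes>\<^bsub>Aut \<Q>\<^esub> \<rho> h = \<rho> h \<otimes>\<^bsub>Aut \<Q>\<^esub> \<zeta> m"
  using assms
  by (intro extensionalityI[where A = "X \<times> carrier G"])
    (auto simp: mult_Aut compose_eq zeta_apply conj_map_apply act_closed int_pow_conj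
      act_mult[symmetric] m_assoc mult_inv_cancel_left)

text \<open>The exponent \<open>g\<^sup>-\<^sup>1 h\<close> in the quandle operation splits into \<open>g\<^sup>-\<^sup>1\<close>, which \<open>\<zeta>\<^sub>-\<^sub>1\<close> contributes
  without touching the second coordinate, and \<open>h\<close>, which \<open>\<rho>\<^sub>h\<close> contributes together with the
  conjugation. In particular the point symmetry does not depend on \<open>y\<close>.\<close>

lemma point_symmetry_eq:
  assumes "y \<in> X" and "h \<in> carrier G"
  shows "point_symmetry \<Q> (y, h) = \<zeta> (- 1) \<otimes>\<^bsub>Aut \<Q>\<^esub> \<rho> h"
  using assms
  by (intro extensionalityI[where A = "X \<times> carrier G"])
    (auto simp: point_symmetry_def mult_Aut compose_eq zeta_apply conj_map_apply act_closed
      int_pow_neg act_mult)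

text \<open>Invertibility comes for free: \<open>\<zeta>\<close> and \<open>\<rho>\<close> turn inverses of integers and of group elements
  into inverse maps.\<close>

lemma zeta_auto: "\<zeta> m \<in> carrier (Aut \<Q>)"
proof -
  have closed: "\<zeta> n p \<in> X \<times> carrier G" if "p \<in> X \<times> carrier G" for n p
    using that by (auto simp: zeta_apply act_closed)
  have inverse: "\<zeta> n (\<zeta> k p) = p" if "k + n = 0" "p \<in> X \<times> carrier G" for n k p
    using fun_cong[OF zeta_mult[of k n], of p] that
    by (simp add: zeta_zero mult_Aut one_Aut compose_eq)
  have "bij_betw (\<zeta> m) (X \<times> carrier G) (X \<times> carrier G)"
    by (rule bij_betw_byWitness[where f' = "\<zeta> (- m)"];
        intro ballI image_subsetI inverse closed) simp_all
  moreover have "\<zeta> m \<in> extensional (X \<times> carrier G)"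
    by (simp add: zeta_def)
  moreover have "\<zeta> m ((x, g) \<triangleleft>\<^bsub>\<Q>\<^esub> (y, h)) = \<zeta> m (x, g) \<triangleleft>\<^bsub>\<Q>\<^esub> \<zeta> m (y, h)"
    if "x \<in> X" "g \<in> carrier G" "y \<in> X" "h \<in> carrier G" for x g y h
  proof -
    \<comment> \<open>the first coordinates agree because \<open>g\<^sup>m\<close> commutes with \<open>g\<^sup>-\<^sup>1\<close>\<close>
    have "inv g \<otimes> g [^] m = g [^] m \<otimes> inv g"
      using int_pow_mult[OF that(2), of "- 1" m] int_pow_mult[OF that(2), of m "- 1"] that
      by (simp add: int_pow_neg)
    then have "inv g \<otimes> (g [^] m \<otimes> h) = g [^] m \<otimes> (inv g \<otimes> h)"
      using that by (simp add: m_assoc[symmetric])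
    then show ?thesis
      using that by (simp add: zeta_apply act_closed int_pow_conj act_mult[symmetric] m_assoc
          mult_inv_cancel_left)
  qed
  ultimately show ?thesis
    by (auto simp: Aut_def map_group_def quandle_auto_def Bij_def)
qed

lemma conj_map_auto:
  assumes h: "h \<in> carrier G"
  shows "\<rho> h \<in> carrier (Aut \<Q>)"
proof -
  have closed: "\<rho> k p \<in> X \<times> carrier G" if "k \<in> carrier G" "p \<in> X \<times> carrier G" for k p
    using that by (auto simp: conj_map_apply act_closed)
  have inverse: "\<rho> k (\<rho> l p) = p"
    if "k \<in> carrier G" "l \<in> carrier G" "l \<otimes> k = \<one>" "p \<in> X \<times> carrier G" for k l p
    using fun_cong[OF conj_map_mult[of l k], of p] that
    by (simp add: conj_map_one mult_Aut one_Aut compose_eq)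
  have "bij_betw (\<rho> h) (X \<times> carrier G) (X \<times> carrier G)"
    by (rule bij_betw_byWitness[where f' = "\<rho> (inv h)"];
        intro ballI image_subsetI inverse closed) (simp_all add: h)
  moreover have "\<rho> h \<in> extensional (X \<times> carrier G)"
    by (simp add: conj_map_def)
  moreover have "\<rho> h ((x, g) \<triangleleft>\<^bsub>\<Q>\<^esub> (y, k)) = \<rho> h (x, g) \<triangleleft>\<^bsub>\<Q>\<^esub> \<rho> h (y, k)"
    if "x \<in> X" "g \<in> carrier G" "y \<in> X" "k \<in> carrier G" for x g y k
    using that h by (simp add: conj_map_apply act_closed act_mult[symmetric] inv_mult_group m_assoc
        mult_inv_cancel_left)
  ultimately show ?thesis
    by (auto simp: Aut_def map_group_def quandle_auto_def Bij_def)
qed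

section \<open>The inner automorphism group as an internal direct product\<close>

text \<open>Since \<open>\<zeta>\<^sub>m\<close> fixes the points \<open>(x, 1)\<close>, their first coordinates put \<open>h\<close> into the kernel of the
  action; since \<open>\<zeta>\<^sub>m\<close> preserves all second coordinates, \<open>h\<close> is central. This one computation
  serves both for the kernel of \<open>\<rho>\<close> (with \<open>m = 0\<close>) and for the triviality of \<open>Z \<inter> \<rho>(G)\<close>.\<close>

lemma conj_map_eq_zeta_imp_center_kernel:
  assumes ne: "X \<noteq> {}" and h: "h \<in> carrier G" and eq: "\<rho> h = \<zeta> m"
  shows "h \<in> center G \<inter> action_kernel G X \<Phi>"
proof -
  have val: "\<Phi> x h = \<Phi> x (g [^] m)" "inv h \<otimes> g \<otimes> h = g" if "x \<in> X" "g \<in> carrier G" for x g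
    using fun_cong[OF eq, of "(x, g)"] that by (auto simp: conj_map_apply zeta_apply)
  have "\<Phi> x h = x" if "x \<in> X" for x
    using val(1)[OF that one_closed] that by (simp add: act_one)
  moreover have "h \<otimes> g = g \<otimes> h" if g: "g \<in> carrier G" for g
  proof -
    obtain x where "x \<in> X" using ne by blast
    from val(2)[OF this g] have "h \<otimes> g = h \<otimes> (inv h \<otimes> g \<otimes> h)" by simp
    then show ?thesis
      using g h by (simp add: m_assoc mult_inv_cancel_left)
  qed
  ultimately show ?thesis
    using h by (simp add: center_def action_kernel_def)
qed

lemma conj_map_center_kernel:
  assumes "h \<in> center G \<inter> action_kernel G X \<Phi>"
  shows "\<rho> h = \<one>\<^bsub>Aut \<Q>\<^esub>"
proof -
  have h: "h \<in> carrier G" and comm: "\<And>g. g \<in> carrier G \<Longrightarrow> g \<otimes> h = h \<otimes> g"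
    and fixes_X: "\<And>x. x \<in> X \<Longrightarrow> \<Phi> x h = x"
    using assms by (simp_all add: center_def action_kernel_def)
  have "\<rho> h (x, g) = (x, g)" if "x \<in> X" "g \<in> carrier G" for x g
  proof -
    have "inv h \<otimes> g \<otimes> h = inv h \<otimes> (h \<otimes> g)"
      using that h by (simp only: m_assoc inv_closed comm)
    then show ?thesis
      using that h by (simp add: conj_map_apply fixes_X mult_inv_cancel_left)
  qed
  then show ?thesis
    by (intro extensionalityI[where A = "X \<times> carrier G"]) (auto simp: one_Aut conj_map_def)
qed

context
  assumes ne: "X \<noteq> {}"
begin

interpretation Q: quandle \<Q>
  by (rule quandle_action_quandle[OF ne])

interpretation Aut: group "Aut \<Q>"
  by (rule Q.group_Aut)

interpretation Inn: group "Inn \<Q>"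
  by (rule Q.group_Inn)

text \<open>The point symmetries at the points \<open>(y, 1)\<close> are all equal to \<open>\<zeta>\<^sub>-\<^sub>1\<close>, which generates the
  cyclic group of the \<open>\<zeta>\<^sub>m\<close>.\<close>

lemma zeta_inner: "\<zeta> m \<in> carrier (Inn \<Q>)"
proof -
  obtain y where y: "y \<in> X" using ne by blast
  have "\<zeta> (- 1) = point_symmetry \<Q> (y, \<one>)"
    using y zeta_auto by (simp add: point_symmetry_eq conj_map_one)
  then have "\<zeta> (- 1) \<in> carrier (Inn \<Q>)"
    using y by (auto simp: Inn_def intro!: generate.incl)
  then have "\<zeta> (- 1) [^]\<^bsub>Aut \<Q>\<^esub> (- m) \<in> carrier (Inn \<Q>)"
    by (rule Aut.subgroup_int_pow_closed[OF Q.subgroup_Inn])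
  moreover have "\<zeta> \<in> hom integer_group (Aut \<Q>)"
    by (auto intro!: homI simp: zeta_auto zeta_mult)
  then have "\<zeta> (- 1) [^]\<^bsub>Aut \<Q>\<^esub> (- m) = \<zeta> m"
    using hom_int_pow[of \<zeta> integer_group "Aut \<Q>" "- 1" "- m"] by (simp add: Aut.is_group)
  ultimately show ?thesis by simp
qed

lemma conj_map_inner:
  assumes h: "h \<in> carrier G"
  shows "\<rho> h \<in> carrier (Inn \<Q>)"
proof -
  obtain y where y: "y \<in> X" using ne by blast
  have "\<rho> h = \<zeta> 1 \<otimes>\<^bsub>Aut \<Q>\<^esub> (\<zeta> (- 1) \<otimes>\<^bsub>Aut \<Q>\<^esub> \<rho> h)"
    using h by (simp add: Aut.m_assoc[symmetric] zeta_auto conj_map_auto zeta_mult zeta_zero)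
  also have "\<dots> = \<zeta> 1 \<otimes>\<^bsub>Aut \<Q>\<^esub> point_symmetry \<Q> (y, h)"
    using y h by (simp add: point_symmetry_eq)
  also have "\<dots> \<in> carrier (Inn \<Q>)"
    using y h zeta_inner[of 1]
    by (intro subgroup.m_closed[OF Q.subgroup_Inn]) (auto simp: Inn_def intro: generate.incl)
  finally show ?thesis .
qed

lemma zeta_hom: "group_hom integer_group (Inn \<Q>) \<zeta>"
  by (auto intro!: group_hom.intro group_hom_axioms.intro homI Inn.is_group
      simp: zeta_inner zeta_mult mult_Inn)

lemma conj_map_hom: "group_hom G (Inn \<Q>) \<rho>"
  by (auto intro!: group_hom.intro group_hom_axioms.intro homI Inn.is_group is_group
      simp: conj_map_inner conj_map_mult mult_Inn)

lemma subgroup_range_zeta: "subgroup (range \<zeta>) (Inn \<Q>)"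
  using group_hom.img_is_subgroup[OF zeta_hom] by simp

lemma subgroup_conj_map_image: "subgroup (\<rho> ` carrier G) (Inn \<Q>)"
  by (rule group_hom.img_is_subgroup[OF conj_map_hom])

lemma carrier_Inn: "carrier (Inn \<Q>) = range \<zeta> <#>\<^bsub>Inn \<Q>\<^esub> \<rho> ` carrier G"
proof
  have "subgroup (range \<zeta> <#>\<^bsub>Inn \<Q>\<^esub> \<rho> ` carrier G) (Inn \<Q>)"
    by (rule Inn.subgroup_set_mult_commuting[OF subgroup_range_zeta subgroup_conj_map_image])
      (auto simp: mult_Inn zeta_conj_map_commute)
  then have "subgroup (range \<zeta> <#>\<^bsub>Inn \<Q>\<^esub> \<rho> ` carrier G) (Aut \<Q>)"
    using Aut.incl_subgroup[OF Q.subgroup_Inn] by (simp add: Inn_def)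
  moreover have "point_symmetry \<Q> ` carrier \<Q> \<subseteq> range \<zeta> <#>\<^bsub>Inn \<Q>\<^esub> \<rho> ` carrier G"
    by (auto simp: point_symmetry_eq set_mult_def mult_Inn) blast
  ultimately show "carrier (Inn \<Q>) \<subseteq> range \<zeta> <#>\<^bsub>Inn \<Q>\<^esub> \<rho> ` carrier G"
    using Aut.generate_subgroup_incl by (auto simp: Inn_def)
  show "range \<zeta> <#>\<^bsub>Inn \<Q>\<^esub> \<rho> ` carrier G \<subseteq> carrier (Inn \<Q>)"
    using zeta_inner conj_map_inner by (auto simp: set_mult_def)
qed

lemma range_zeta_Int_conj_map_image: "range \<zeta> \<inter> \<rho> ` carrier G = {\<one>\<^bsub>Inn \<Q>\<^esub>}"
proof
  show "range \<zeta> \<inter> \<rho> ` carrier G \<subseteq> {\<one>\<^bsub>Inn \<Q>\<^esub>}"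
  proof
    fix f assume "f \<in> range \<zeta> \<inter> \<rho> ` carrier G"
    then obtain h m where h: "h \<in> carrier G" and f: "f = \<rho> h" and eq: "\<rho> h = \<zeta> m"
      by (elim IntE imageE) simp
    have "f = \<one>\<^bsub>Aut \<Q>\<^esub>"
      unfolding f
      by (rule conj_map_center_kernel[OF conj_map_eq_zeta_imp_center_kernel[OF ne h eq]])
    then show "f \<in> {\<one>\<^bsub>Inn \<Q>\<^esub>}"
      by (simp add: one_Inn)
  qed
  show "{\<one>\<^bsub>Inn \<Q>\<^esub>} \<subseteq> range \<zeta> \<inter> \<rho> ` carrier G"
    using subgroup.one_closed[OF subgroup_range_zeta]
      subgroup.one_closed[OF subgroup_conj_map_image] by blast
qed

text \<open>The isomorphism with an internal direct product is phrased in terms of generated subgroups of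
  the inner group; this identifies \<open>Z\<close> as one of them, and so shows that it is a group.\<close>

lemma zeta_group_eq: "zeta_group G X \<Phi> = subgroup_generated (Inn \<Q>) (range \<zeta>)"
proof (rule monoid.equality)
  show "carrier (zeta_group G X \<Phi>) = carrier (subgroup_generated (Inn \<Q>) (range \<zeta>))"
    using subgroup.carrier_subgroup_generated_subgroup[OF subgroup_range_zeta]
    by (auto simp: zeta_group_def map_group_def)
qed (simp_all add: zeta_group_def map_group_def fun_eq_iff mult_Inn mult_Aut one_Inn one_Aut)

lemma group_zeta_group: "group (zeta_group G X \<Phi>)"
  by (simp add: zeta_group_eq)

lemma kernel_conj_map: "kernel G (Inn \<Q>) \<rho> = center G \<inter> action_kernel G X \<Phi>"
proof
  show "kernel G (Inn \<Q>) \<rho> \<subseteq> center G \<inter> action_kernel G X \<Phi>"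
    using conj_map_eq_zeta_imp_center_kernel[OF ne, of _ 0]
    by (auto simp: kernel_def one_Inn zeta_zero)
  show "center G \<inter> action_kernel G X \<Phi> \<subseteq> kernel G (Inn \<Q>) \<rho>"
    using conj_map_center_kernel by (auto simp: kernel_def one_Inn center_def)
qed

lemma FactGroup_iso_conj_map_image:
  "G Mod (center G \<inter> action_kernel G X \<Phi>) \<cong> subgroup_generated (Inn \<Q>) (\<rho> ` carrier G)"
proof -
  let ?R = "subgroup_generated (Inn \<Q>) (\<rho> ` carrier G)"
  have carrier: "carrier ?R = \<rho> ` carrier G"
    by (rule subgroup.carrier_subgroup_generated_subgroup[OF subgroup_conj_map_image])
  interpret R: group_hom G ?R \<rho>
    by (auto intro!: group_hom.intro group_hom_axioms.intro homI is_group
        simp: carrier conj_map_mult mult_Inn)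
  have "kernel G ?R \<rho> = center G \<inter> action_kernel G X \<Phi>"
    using kernel_conj_map by (simp add: kernel_def)
  then show ?thesis
    using R.FactGroup_iso carrier by simp
qed

text \<open>Multiplication maps \<open>Z \<times> \<rho>(G)\<close> isomorphically onto the inner group, since the two subgroups
  commute, generate it and meet trivially.\<close>

lemma Inn_iso:
  "Inn \<Q> \<cong> zeta_group G X \<Phi> \<times>\<times> (G Mod (center G \<inter> action_kernel G X \<Phi>))"
proof -
  let ?R = "subgroup_generated (Inn \<Q>) (\<rho> ` carrier G)"
  interpret S: group_disjoint_sum "Inn \<Q>" "range \<zeta>" "\<rho> ` carrier G"
    by (simp add: group_disjoint_sum_def Inn.is_group subgroup_range_zeta subgroup_conj_map_image)
  interpret Z: group "zeta_group G X \<Phi>" by (rule group_zeta_group)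
  interpret N: normal "center G \<inter> action_kernel G X \<Phi>" G by (rule normal_center_Int_kernel)
  have "(\<lambda>(f, k). f \<otimes>\<^bsub>Inn \<Q>\<^esub> k) \<in> iso (zeta_group G X \<Phi> \<times>\<times> ?R) (Inn \<Q>)"
    unfolding zeta_group_eq S.iso_group_mul_alt
    using range_zeta_Int_conj_map_image carrier_Inn by (auto simp: mult_Inn zeta_conj_map_commute)
  then have "zeta_group G X \<Phi> \<times>\<times> ?R \<cong> Inn \<Q>"
    by (auto simp: is_iso_def)
  with Z.DirProd_iso_trans[OF iso_refl FactGroup_iso_conj_map_image]
  have "zeta_group G X \<Phi> \<times>\<times> (G Mod (center G \<inter> action_kernel G X \<Phi>)) \<cong> Inn \<Q>"
    by (rule iso_trans)
  then show ?thesis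
    by (rule group.iso_sym[OF DirProd_group[OF Z.is_group N.factorgroup_is_group]])
qed

end

end

theorem theorem1p2:
  fixes G :: "('g, 'c) monoid_scheme"
    and X :: "'x set"
    and \<Phi> :: "'x \<Rightarrow> 'g \<Rightarrow> 'x"
  assumes "right_action G X \<Phi>"
    and "X \<noteq> {}"
  shows "group (zeta_group G X \<Phi>) \<and>
    Inn (action_quandle G X \<Phi>) \<cong>
      zeta_group G X \<Phi> \<times>\<times> (G Mod (center G \<inter> action_kernel G X \<Phi>))"
  using right_action.group_zeta_group[OF assms] right_action.Inn_iso[OF assms] by blast

end
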